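(* For any $P\in\mathcal{P}\cup\{0\}$, we have $$\mathcal{T}^k(P)-P^*=\mathcal{T}^k(P)-\mathcal{T}^k(P^* )\preceq \gamma^k (A(F^* )^T)^k(P-P^* )A(F^* )^k\quad\text{for all integers }k\ge 0,$$ and $\gamma^k (A(F^* )^T)^k(P-P^* )A(F^* )^k\to 0$ as $k\to\infty$.
   Context: $\mathbb{S}^N$ denotes the real symmetric $N\times N$ matrices; $\mathbb{S}^N_+$, $\mathbb{S}^N_{++}$ are the positive semidefinite and positive definite ones; $\preceq,\succeq$ is the Loewner order. Fix $A\in\mathbb{R}^{n\times n}$, $B\in\mathbb{R}^{n\times m}$, a discount factor $\gamma\in(0,1]$, $Q\in\mathbb{S}^n$ with $Q\succeq 0$, $R\in\mathbb{S}^m$ with $R\succ 0$. Standing assumption: $(A,B)$ is stabilizable and $Q=C^TC$ for some matrix $C$ with $(A,C)$ detectable (discrete-time sense). Put $\Lambda=\begin{bmatrix}Q & 0 \\ 0 & R\end{bmatrix}$ and, for $F\in\mathbb{R}^{m\times n}$, $A(F)=\begin{bmatrix}A & B \\ F A & F B\end{bmatrix}\in\mathbb{R}^{(n+m)\times(n+m)}$. $X^*$ is the unique solution $X\succeq 0$ of the algebraic Riccati equation $X=\gamma A^TXA-\gamma A^TXB(R+\gamma B^TXB)^{-1}\gamma B^TXA+Q$; $F^*=-(R+\gamma B^TX^*B)^{-1}\gamma B^TX^*A$ (which satisfies $\rho(\gamma^{1/2}(A+BF^* ))<1$); and $P^*=\begin{bmatrix}Q+\gamma A^TX^*A & \gamma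 A^TX^*B \\ \gamma B^TX^*A & R+\gamma B^TX^*B\end{bmatrix}$, which satisfies $P^*=\Lambda+\gamma A(F^* )^TP^*A(F^* )$. Matrices $P\in\mathbb{S}^{n+m}$ are partitioned as $P=\begin{bmatrix}P_{11} & P_{12} \\ P_{12}^T & P_{22}\end{bmatrix}$ with $P_{11}\in\mathbb{S}^n$, $P_{12}\in\mathbb{R}^{n\times m}$, $P_{22}\in\mathbb{S}^m$. $\mathcal{P}=\{P\in\mathbb{S}^{n+m}_+:P_{22}\in\mathbb{S}^m_{++}\}$. The Bellman operator is $\mathcal{T}(P)=\Lambda+\gamma A(-P_{22}^{-1}P_{12}^T)^TPA(-P_{22}^{-1}P_{12}^T)$ for $P\in\mathcal{P}$, and $\mathcal{T}(0)=\Lambda$; it maps $\mathcal{P}\cup\{0\}$ into $\mathcal{P}$, and $\mathcal{T}^k$ is its $k$-fold composition. *)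

theory Defs
  imports "HOL-Analysis.Analysis"
begin

text \<open>
  An $r \times c$ real matrix has type \<open>real^'c^'r\<close>; a matrix of size $n + m$ is indexed by
  the sum type \<open>'n + 'm\<close>. Products are \<open>**\<close>; the class operations \<open>*\<close> and \<open>^\<close> act
  entrywise on \<open>vec\<close>, and \<open>\<le>\<close> is the entrywise order, so none of these is used on
  matrices below.
\<close>

definition symmetric_mats :: "(real^'n^'n) set" where
  "symmetric_mats = {M. transpose M = M}"

definition psd_mats :: "(real^'n^'n) set" where
  "psd_mats = {M \<in> symmetric_mats. \<forall>x. 0 \<le> x \<bullet> (M *v x)}"

definition pd_mats :: "(real^'n^'n) set" where
  "pd_mats = {M \<in> symmetric_mats. \<forall>x. x \<noteq> 0 \<longrightarrow> 0 < x \<bullet> (M *v x)}"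

definition loewner_le :: "real^'n^'n \<Rightarrow> real^'n^'n \<Rightarrow> bool"  (infix "\<preceq>\<^sub>L" 50) where
  "M \<preceq>\<^sub>L N \<longleftrightarrow> N - M \<in> psd_mats"

definition mat_power :: "real^'n^'n \<Rightarrow> nat \<Rightarrow> real^'n^'n" where
  "mat_power M k = (((**) M) ^^ k) (mat 1)"

definition complex_spectrum :: "real^'n^'n \<Rightarrow> complex set" where
  "complex_spectrum M =
     {c. \<exists>v::complex^'n. v \<noteq> 0 \<and> map_matrix complex_of_real M *v v = c *s v}"

text \<open>The spectrum is finite and nonempty, so this supremum is a maximum.\<close>

definition spectral_radius :: "real^'n^'n \<Rightarrow> real" where
  "spectral_radius M = Sup (cmod ` complex_spectrum M)"

definition stabilizable :: "real^'n^'n \<Rightarrow> real^'m^'n \<Rightarrow> bool" where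
  "stabilizable A B \<longleftrightarrow> (\<exists>K :: real^'n^'m. spectral_radius (A + B ** K) < 1)"

definition detectable :: "real^'n^'n \<Rightarrow> real^'n^'p \<Rightarrow> bool" where
  "detectable A C \<longleftrightarrow> (\<exists>L :: real^'p^'n. spectral_radius (A + L ** C) < 1)"

definition block_mat ::
    "real^'c^'r \<Rightarrow> real^'d^'r \<Rightarrow> real^'c^'s \<Rightarrow> real^'d^'s \<Rightarrow> real^('c::finite + 'd::finite)^('r::finite + 's::finite)" where
  "block_mat M11 M12 M21 M22 = (\<chi> i j. case i of
       Inl a \<Rightarrow> (case j of Inl b \<Rightarrow> M11 $ a $ b | Inr b \<Rightarrow> M12 $ a $ b)
     | Inr a \<Rightarrow> (case j of Inl b \<Rightarrow> M21 $ a $ b | Inr b \<Rightarrow> M22 $ a $ b))"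

definition block12 :: "real^('n::finite + 'm::finite)^('n + 'm) \<Rightarrow> real^'m^'n" where
  "block12 P = (\<chi> i j. P $ Inl i $ Inr j)"

definition block22 :: "real^('n::finite + 'm::finite)^('n + 'm) \<Rightarrow> real^'m^'m" where
  "block22 P = (\<chi> i j. P $ Inr i $ Inr j)"

definition stage_cost :: "real^'n^'n \<Rightarrow> real^'m^'m \<Rightarrow> real^('n::finite + 'm::finite)^('n + 'm)" where
  "stage_cost Q R = block_mat Q 0 0 R"

definition closed_loop ::
    "real^'n^'n \<Rightarrow> real^'m^'n \<Rightarrow> real^'n^'m \<Rightarrow> real^('n::finite + 'm::finite)^('n + 'm)" where
  "closed_loop A B F = block_mat A B (F ** A) (F ** B)"

definition riccati ::
    "real^'n^'n \<Rightarrow> real^'m^'n \<Rightarrow> real^'n^'n \<Rightarrow> real^'m^'m \<Rightarrow> real \<Rightarrow> real^'n^'n \<Rightarrow> real^'n^'n" where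
  "riccati A B Q R \<gamma> X =
     \<gamma> *\<^sub>R (transpose A ** X ** A)
     - (\<gamma> *\<^sub>R (transpose A ** X ** B)) ** matrix_inv (R + \<gamma> *\<^sub>R (transpose B ** X ** B))
         ** (\<gamma> *\<^sub>R (transpose B ** X ** A))
     + Q"

definition riccati_gain ::
    "real^'n^'n \<Rightarrow> real^'m^'n \<Rightarrow> real^'m^'m \<Rightarrow> real \<Rightarrow> real^'n^'n \<Rightarrow> real^'n^'m" where
  "riccati_gain A B R \<gamma> X =
     - (matrix_inv (R + \<gamma> *\<^sub>R (transpose B ** X ** B)) ** (\<gamma> *\<^sub>R (transpose B ** X ** A)))"

definition q_matrix ::
    "real^'n^'n \<Rightarrow> real^'m^'n \<Rightarrow> real^'n^'n \<Rightarrow> real^'m^'m \<Rightarrow> real \<Rightarrow> real^'n^'n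
      \<Rightarrow> real^('n::finite + 'm::finite)^('n + 'm)" where
  "q_matrix A B Q R \<gamma> X = block_mat
     (Q + \<gamma> *\<^sub>R (transpose A ** X ** A)) (\<gamma> *\<^sub>R (transpose A ** X ** B))
     (\<gamma> *\<^sub>R (transpose B ** X ** A))     (R + \<gamma> *\<^sub>R (transpose B ** X ** B))"

definition admissible :: "(real^('n::finite + 'm::finite)^('n + 'm)) set" where
  "admissible = {P \<in> psd_mats. block22 P \<in> pd_mats}"

text \<open>
  The operator is meant on \<open>admissible \<union> {0}\<close> only. The zero matrix is singled out because
  \<open>matrix_inv\<close> is unspecified at singular matrices.
\<close>

definition bellman ::
    "real^'n^'n \<Rightarrow> real^'m^'n \<Rightarrow> real^'n^'n \<Rightarrow> real^'m^'m \<Rightarrow> real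
      \<Rightarrow> real^('n::finite + 'm::finite)^('n + 'm) \<Rightarrow> real^('n::finite + 'm::finite)^('n + 'm)" where
  "bellman A B Q R \<gamma> P =
     (if P = 0 then stage_cost Q R
      else let G = closed_loop A B (- (matrix_inv (block22 P) ** transpose (block12 P)))
           in stage_cost Q R + \<gamma> *\<^sub>R (transpose G ** P ** G))"

end

theory Submission
  imports Defs "HOL-Computational_Algebra.Fundamental_Theorem_Algebra"
begin

text \<open>
  \<^emph>\<open>Why the bound holds.\<close> For a fixed positive semidefinite \<open>P\<close>, one Bellman step chooses for each
  state the input that minimises the quadratic form of \<open>P\<close>. Using the fixed optimal feedback \<open>F\<^sup>*\<close>
  instead can only increase the result, in the Loewner order; this is the completion of the
  square in \<open>greedy_gain_optimal\<close>. The step with fixed feedback is affine in \<open>P\<close>, and \<open>P\<^sup>*\<close> is a fixed point of it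
  as well as of the Bellman operator, by the Riccati equation (\<open>q_matrix_lyapunov\<close>). Subtracting \<open>P\<^sup>*\<close>
  therefore leaves \<open>\<T>(P) - P\<^sup>* \<preceq> \<gamma> A(F\<^sup>*)\<^sup>T (P - P\<^sup>*) A(F\<^sup>*)\<close>, and this bound iterates
  (\<open>bellman_iterate_le\<close>).
  
  \<^emph>\<open>Why it tends to zero.\<close> The matrix \<open>A(F)\<close> is a product \<open>S T\<close>, where \<open>S\<close> maps a state \<open>x\<close> to the pair
  \<open>(x, F x)\<close> and \<open>T\<close> maps a state and an input to the next state, and \<open>T S = A + B F\<close>. So it suffices that the
  powers of \<open>\<surd>\<gamma> (A + B F\<^sup>*)\<close> vanish. The Riccati equation is a Lyapunov equation for this matrix
  (\<open>riccati_lyapunov\<close>); an eigenvector with eigenvalue outside the open unit disc would cost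
  nothing, hence be invisible to both \<open>C\<close> and \<open>F\<^sup>*\<close>, which detectability excludes
  (\<open>lyapunov_closed_loop_spectrum\<close>). That eigenvalues inside the open unit disc force the powers to vanish
  is proved vector by vector, by factoring a polynomial that annihilates the orbit into linear factors
  (\<open>summable_iterate_of_annihilating_poly\<close>).
\<close>

section \<open>Powers of a matrix whose eigenvalues lie in the open unit disc\<close>

text \<open>
  The vector \<open>p(M) v\<close>. Letting the polynomial act on one vector at a time avoids matrix
  polynomials: only a polynomial annihilating the orbit of a given \<open>v\<close> is ever needed.
\<close>

definition poly_apply :: "complex^'n^'n \<Rightarrow> complex poly \<Rightarrow> complex^'n \<Rightarrow> complex^'n" where
  "poly_apply M p v = (\<Sum>i\<le>degree p. coeff p i *s (((*v) M) ^^ i) v)"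

lemma poly_apply_bound:
  assumes "degree p \<le> N"
  shows "poly_apply M p v = (\<Sum>i\<le>N. coeff p i *s (((*v) M) ^^ i) v)"
  unfolding poly_apply_def using assms
  by (intro sum.mono_neutral_left) (auto simp: coeff_eq_0)

lemma iterate_mult_vec_diff:
  "(((*v) M) ^^ i) (v - w) = (((*v) M) ^^ i) v - (((*v) M) ^^ i) w" for M :: "complex^'n^'n"
  by (induction i) (simp_all add: matrix_vector_mult_diff_distrib)

lemma iterate_mult_vec_smult:
  "(((*v) M) ^^ i) (c *s v) = c *s (((*v) M) ^^ i) v" for M :: "complex^'n^'n"
  by (induction i) (simp_all add: vector_scalar_commute)

text \<open>
  A linear factor of the polynomial can be moved onto the vector, and, because \<open>M\<close> commutes with
  \<open>q(M)\<close>, out in front of \<open>q(M) v\<close>. The induction on the degree below uses the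
  first form to split off a root, and the second to discard a root outside the unit disc.
\<close>

lemma poly_apply_linear_factor:
  "poly_apply M ([:- c, 1:] * q) v = poly_apply M q (M *v v - c *s v)"
proof -
  let ?N = "degree q" and ?I = "\<lambda>i. (((*v) M) ^^ i) v"
  have "poly_apply M ([:- c, 1:] * q) v = (\<Sum>i\<le>Suc ?N. coeff ([:- c, 1:] * q) i *s ?I i)"
    by (intro poly_apply_bound order.trans[OF degree_mult_le]) simp
  also have "\<dots> = (\<Sum>i\<le>Suc ?N. coeff (pCons 0 q) i *s ?I i) - (\<Sum>i\<le>Suc ?N. (c * coeff q i) *s ?I i)"
    unfolding sum_subtractf[symmetric] by (intro sum.cong) simp_all
  also have "(\<Sum>i\<le>Suc ?N. coeff (pCons 0 q) i *s ?I i) = (\<Sum>i\<le>?N. coeff q i *s ?I (Suc i))"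
    by (subst sum.atMost_Suc_shift) simp
  also have "(\<Sum>i\<le>Suc ?N. (c * coeff q i) *s ?I i) = (\<Sum>i\<le>?N. (c * coeff q i) *s ?I i)"
    by (simp add: coeff_eq_0)
  also have "(\<Sum>i\<le>?N. coeff q i *s ?I (Suc i)) - \<dots> = poly_apply M q (M *v v - c *s v)"
    unfolding poly_apply_def sum_subtractf[symmetric]
    by (intro sum.cong)
       (simp_all add: iterate_mult_vec_diff iterate_mult_vec_smult funpow_swap1 vector_ssub_ldistrib vector_smult_assoc mult.commute)
  finally show ?thesis .
qed

lemma poly_apply_linear_factor_outer:
  "poly_apply M q (M *v v - c *s v) = M *v poly_apply M q v - c *s poly_apply M q v"
proof -
  have "M *v (coeff q i *s (((*v) M) ^^ i) v) - c *s (coeff q i *s (((*v) M) ^^ i) v)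
      = coeff q i *s (((*v) M) ^^ i) (M *v v - c *s v)" for i
    by (simp add: iterate_mult_vec_diff iterate_mult_vec_smult funpow_swap1 vector_ssub_ldistrib
        vector_scalar_commute vector_smult_assoc mult.commute)
  then show ?thesis
    unfolding poly_apply_def linear_sum[OF matrix_vector_mul_linear] vec.scale_sum_right
      sum_subtractf[symmetric]
    by (intro sum.cong) simp_all
qed

text \<open>
  More iterates \<open>M^i v\<close> than the dimension of the space cannot be linearly independent, and a
  dependence between them is a polynomial annihilating \<open>v\<close>. Real coefficients suffice, so the
  dimension is counted over the reals.
\<close>

lemma annihilating_poly_exists:
  fixes M :: "complex^'n^'n" and v :: "complex^'n"
  shows "\<exists>p. p \<noteq> 0 \<and> poly_apply M p v = 0"
proof -
  define I where "I = (\<lambda>i. (((*v) M) ^^ i) v)"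
  have bound: "poly_apply M p v = (\<Sum>i\<le>N. coeff p i *s I i)" if "degree p \<le> N" for p N
    unfolding I_def using that by (rule poly_apply_bound)
  let ?d = "DIM(complex^'n)"
  show ?thesis
  \<comment> \<open>Dependence of the set of iterates says nothing about the family if two iterates coincide.\<close>
  proof (cases "inj_on I {..?d}")
    case False
    then obtain i j where ij: "i < j" "I i = I j"
      unfolding inj_on_def by (metis nat_neq_iff)
    let ?p = "monom 1 j - monom 1 i :: complex poly"
    have "coeff ?p j \<noteq> 0" using ij by simp
    then have "?p \<noteq> 0" by force
    have "degree ?p \<le> j"
      using ij by (intro degree_diff_le) (auto simp: degree_monom_eq)
    then have "poly_apply M ?p v = (\<Sum>k\<le>j. coeff ?p k *s I k)"
      by (rule bound)
    also have "\<dots> = (\<Sum>k\<le>j. (if k = j then I j else 0) - (if k = i then I i else 0))"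
      using ij(1) by (intro sum.cong) (auto simp: vector_sub_rdistrib)
    also have "\<dots> = 0"
      using ij by (simp add: sum_subtractf sum.delta)
    finally have "poly_apply M ?p v = 0" .
    with \<open>?p \<noteq> 0\<close> show ?thesis by blast
  next
    case True
    then have "card (I ` {..?d}) = Suc ?d"
      by (simp add: card_image)
    then have "dependent (I ` {..?d})"
      by (intro dependent_biggerset) auto
    then obtain u where u: "\<exists>x\<in>I ` {..?d}. u x \<noteq> 0" "(\<Sum>x\<in>I ` {..?d}. u x *\<^sub>R x) = 0"
      using dependent_finite[of "I ` {..?d}"] by auto
    define p where "p = (\<Sum>i\<le>?d. monom (complex_of_real (u (I i))) i)"
    have co: "coeff p i = (if i \<le> ?d then of_real (u (I i)) else 0)" for i
      unfolding p_def by (simp add: coeff_sum sum.delta)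
    have "p \<noteq> 0"
      using u(1) co by (metis (no_types, lifting) atMost_iff coeff_0 imageE of_real_eq_0_iff)
    have "degree p \<le> ?d"
      by (rule degree_le) (simp add: co)
    have "poly_apply M p v = (\<Sum>i\<le>?d. u (I i) *\<^sub>R I i)"
      unfolding bound[OF \<open>degree p \<le> ?d\<close>] by (intro sum.cong)
         (simp_all add: co vec_eq_iff scaleR_conv_of_real[where 'a = complex])
    also have "\<dots> = 0"
      using u(2) unfolding sum.reindex[OF True] o_def .
    finally show ?thesis
      using \<open>p \<noteq> 0\<close> by blast
  qed
qed

text \<open>
  Adding up the first \<open>n\<close> instances of the recursion bounds the partial sum \<open>S\<close> of \<open>a\<close> by
  \<open>a 0 + r * S + suminf b\<close>, which can be solved for \<open>S\<close>.
\<close>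

lemma summable_contraction_perturbed:
  fixes a b :: "nat \<Rightarrow> real"
  assumes "\<And>k. 0 \<le> a k" "\<And>k. 0 \<le> b k" "0 \<le> r" "r < 1"
    and step: "\<And>k. a (Suc k) \<le> r * a k + b k" and "summable b"
  shows "summable a"
proof (rule summableI_nonneg_bounded)
  fix n
  have "(\<Sum>k<Suc n. a k) \<le> a 0 + r * (\<Sum>k<n. a k) + (\<Sum>k<n. b k)"
    using sum_mono[of "{..<n}" "\<lambda>k. a (Suc k)" "\<lambda>k. r * a k + b k"] step
    by (simp add: sum.lessThan_Suc_shift sum.distrib sum_distrib_left del: sum.lessThan_Suc)
  moreover have "(\<Sum>k<n. b k) \<le> suminf b"
    using assms by (intro sum_le_suminf) auto
  moreover have "(\<Sum>k<n. a k) \<le> (\<Sum>k<Suc n. a k)"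
    using assms by simp
  ultimately have "(\<Sum>k<n. a k) * (1 - r) \<le> a 0 + suminf b"
    by (simp add: algebra_simps)
  then show "(\<Sum>k<n. a k) \<le> (a 0 + suminf b) / (1 - r)"
    using \<open>r < 1\<close> by (simp add: pos_le_divide_eq)
qed (use assms in auto)

text \<open>
  Split off one root \<open>c\<close> of the annihilating polynomial at a time. If \<open>|c| < 1\<close>, the orbit of \<open>v\<close>
  is a contraction by \<open>c\<close> driven by the orbit of \<open>(M - c) v\<close>, which is covered by the induction
  hypothesis. If \<open>|c| \<ge> 1\<close>, then \<open>c\<close> is not an eigenvalue, \<open>M - c\<close> is injective, and the
  remaining factor already annihilates \<open>v\<close>. Summability, rather than convergence to zero, is what
  passes through the driven recursion without any epsilon argument.
\<close>

lemma summable_iterate_of_annihilating_poly: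
  fixes M :: "complex^'n^'n"
  assumes spec: "\<And>c v. v \<noteq> 0 \<Longrightarrow> M *v v = c *s v \<Longrightarrow> cmod c < 1"
    and "p \<noteq> 0" "poly_apply M p v = 0"
  shows "summable (\<lambda>k. norm ((((*v) M) ^^ k) v))"
  using assms(2,3)
proof (induction "degree p" arbitrary: p v)
  case 0
  then obtain a where "p = [:a:]" "a \<noteq> 0"
    by (metis degree_eq_zeroE pCons_0_0)
  then have "v = 0"
    using 0 by (simp add: poly_apply_def)
  moreover have "(((*v) M) ^^ k) 0 = 0" for k
    by (induction k) auto
  ultimately show ?case by simp
next
  case (Suc d)
  then have "\<not> constant (poly p)"
    by (simp add: constant_degree)
  then obtain c where "poly p c = 0"
    using fundamental_theorem_of_algebra by blast
  then obtain q where p: "p = [:- c, 1:] * q"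
    by (metis poly_eq_0_iff_dvd dvdE)
  with Suc have q: "q \<noteq> 0" "d = degree q"
    by (auto simp: degree_mult_eq simp del: mult_pCons_left)
  let ?w = "M *v v - c *s v"
  have w: "poly_apply M q ?w = 0"
    using Suc.prems(2) unfolding p poly_apply_linear_factor .
  show ?case
  proof (cases "cmod c < 1")
    case True
    have sw: "summable (\<lambda>k. norm ((((*v) M) ^^ k) ?w))"
      using Suc.hyps(1) q w by blast
    have "(((*v) M) ^^ Suc k) v = c *s (((*v) M) ^^ k) v + (((*v) M) ^^ k) ?w" for k
      by (simp add: iterate_mult_vec_diff iterate_mult_vec_smult funpow_swap1)
    moreover have "norm (c *s x) = cmod c * norm x" for x :: "complex^'n"
      by (simp add: norm_vec_def norm_mult L2_set_right_distrib)
    ultimately have step: "norm ((((*v) M) ^^ Suc k) v)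
        \<le> cmod c * norm ((((*v) M) ^^ k) v) + norm ((((*v) M) ^^ k) ?w)" for k
      by (metis norm_triangle_ineq)
    show ?thesis
      by (rule summable_contraction_perturbed[OF _ _ _ True step sw]) simp_all
  next
    case False
    have "M *v poly_apply M q v = c *s poly_apply M q v"
      using w unfolding poly_apply_linear_factor_outer by simp
    then have "poly_apply M q v = 0"
      using spec False by blast
    then show ?thesis
      using Suc.hyps(1) q by blast
  qed
qed

lemma iterate_tendsto_0_if_eigenvalues_lt_1:
  fixes M :: "complex^'n^'n"
  assumes "\<And>c v. v \<noteq> 0 \<Longrightarrow> M *v v = c *s v \<Longrightarrow> cmod c < 1"
  shows "(\<lambda>k. (((*v) M) ^^ k) v) \<longlonglongrightarrow> 0"
proof -
  obtain p where "p \<noteq> 0" "poly_apply M p v = 0"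
    using annihilating_poly_exists by blast
  with assms have "summable (\<lambda>k. norm ((((*v) M) ^^ k) v))"
    by (rule summable_iterate_of_annihilating_poly)
  then show ?thesis
    using summable_LIMSEQ_zero tendsto_norm_zero_iff by blast
qed

section \<open>Complex eigenvalues of real matrices\<close>

definition re_vec :: "complex^'n \<Rightarrow> real^'n" where "re_vec v = (\<chi> i. Re (v $ i))"
definition im_vec :: "complex^'n \<Rightarrow> real^'n" where "im_vec v = (\<chi> i. Im (v $ i))"

lemma re_im_vec_mult_smult:
  "re_vec (map_matrix complex_of_real M *v v) = M *v re_vec v"
  "im_vec (map_matrix complex_of_real M *v v) = M *v im_vec v"
  "re_vec (c *s v) = Re c *\<^sub>R re_vec v - Im c *\<^sub>R im_vec v"
  "im_vec (c *s v) = Re c *\<^sub>R im_vec v + Im c *\<^sub>R re_vec v"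
  by (simp_all add: vec_eq_iff re_vec_def im_vec_def matrix_vector_mult_def)

lemma complexified_eigenvector_iff:
  "map_matrix complex_of_real M *v v = c *s v \<longleftrightarrow>
     M *v re_vec v = Re c *\<^sub>R re_vec v - Im c *\<^sub>R im_vec v \<and>
     M *v im_vec v = Re c *\<^sub>R im_vec v + Im c *\<^sub>R re_vec v"
proof -
  have "x = y \<longleftrightarrow> re_vec x = re_vec y \<and> im_vec x = im_vec y" for x y :: "complex^'n"
    by (auto simp: vec_eq_iff re_vec_def im_vec_def complex_eq_iff)
  then show ?thesis
    by (metis re_im_vec_mult_smult)
qed

text \<open>
  The operator norm bounds every eigenvalue, so the supremum defining the spectral radius is over a
  bounded set.
\<close>

lemma cmod_eigenvalue_le_spectral_radius:
  fixes M :: "real^'n^'n"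
  assumes "c \<in> complex_spectrum M"
  shows "cmod c \<le> spectral_radius M"
proof -
  obtain K where K: "norm (map_matrix complex_of_real M *v v) \<le> K * norm v" for v :: "complex^'n"
    using linear_bounded[OF matrix_vector_mul_linear] by blast
  have "cmod d \<le> K" if d: "d \<in> complex_spectrum M" for d
  proof -
    obtain v :: "complex^'n" where v: "v \<noteq> 0" "map_matrix complex_of_real M *v v = d *s v"
      using d unfolding complex_spectrum_def by blast
    have "norm (d *s v) = cmod d * norm v"
      by (simp add: norm_vec_def norm_mult L2_set_right_distrib)
    with K[of v] v show ?thesis by simp
  qed
  then have "bdd_above (cmod ` complex_spectrum M)"
    by (auto intro!: bdd_aboveI)
  then show ?thesis
    unfolding spectral_radius_def using assms by (intro cSup_upper) auto
qed

lemma iterate_tendsto_0_if_complex_spectrum_lt_1: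
  fixes N :: "real^'n^'n"
  assumes "\<And>c. c \<in> complex_spectrum N \<Longrightarrow> cmod c < 1"
  shows "(\<lambda>k. (((*v) N) ^^ k) x) \<longlonglongrightarrow> 0"
proof -
  let ?M = "map_matrix complex_of_real N"
  define v where "v = (\<chi> i. complex_of_real (x $ i))"
  have re: "re_vec ((((*v) ?M) ^^ k) v) = (((*v) N) ^^ k) x" for k
    by (induction k) (simp_all add: re_im_vec_mult_smult, simp add: re_vec_def v_def)
  have "(\<lambda>k. (((*v) ?M) ^^ k) v) \<longlonglongrightarrow> 0"
    using assms unfolding complex_spectrum_def
    by (intro iterate_tendsto_0_if_eigenvalues_lt_1) blast
  then have "(\<lambda>k. re_vec ((((*v) ?M) ^^ k) v)) \<longlonglongrightarrow> re_vec 0"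
    unfolding re_vec_def by (intro tendsto_intros)
  then show ?thesis
    unfolding re by (simp add: re_vec_def zero_vec_def)
qed

section \<open>Positive semidefinite matrices\<close>

lemma inner_transpose_mult: "x \<bullet> (transpose G *v w) = (G *v x) \<bullet> w" for G :: "real^'n^'m"
  unfolding transpose_matrix_vector by (subst inner_commute, subst dot_lmul_matrix) (rule inner_commute)

lemma inner_congruence:
  "x \<bullet> ((transpose G ** P ** G) *v y) = (G *v x) \<bullet> (P *v (G *v y))" for G :: "real^'n^'m"
  by (simp only: matrix_vector_mul_assoc[symmetric] inner_transpose_mult)

lemma symmetric_inner_commute:
  assumes "M \<in> symmetric_mats"
  shows "x \<bullet> (M *v y) = y \<bullet> (M *v x)"
  using assms inner_transpose_mult[of x M y] by (simp add: symmetric_mats_def inner_commute del: transpose_matrix_vector)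

lemma psd_congruence:
  assumes "P \<in> psd_mats"
  shows "transpose G ** P ** G \<in> psd_mats"
  using assms unfolding psd_mats_def symmetric_mats_def
  by (auto simp: matrix_transpose_mul matrix_mul_assoc inner_congruence simp del: transpose_matrix_vector)

lemma zero_psd: "0 \<in> psd_mats"
  by (simp add: psd_mats_def symmetric_mats_def transpose_def vec_eq_iff)

lemma psd_add: "M \<in> psd_mats \<Longrightarrow> N \<in> psd_mats \<Longrightarrow> M + N \<in> psd_mats"
  unfolding psd_mats_def symmetric_mats_def
  by (auto simp: transpose_def vec_eq_iff matrix_vector_mult_add_rdistrib inner_add_right)

lemma psd_scaleR: "M \<in> psd_mats \<Longrightarrow> 0 \<le> r \<Longrightarrow> r *\<^sub>R M \<in> psd_mats"
  unfolding psd_mats_def symmetric_mats_def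
  by (auto simp: transpose_scalar scaleR_matrix_vector_assoc[symmetric])

text \<open>
  Multiplication of the complex vector \<open>a + ib\<close> by \<open>s + it\<close>, in real coordinates: the sum on
  either side is the Hermitian form of \<open>X\<close>, which scales with the squared modulus.
\<close>

lemma quadratic_form_scaled_rotation:
  fixes a b :: "real^'n"
  assumes "X \<in> symmetric_mats" and "a' = s *\<^sub>R a - t *\<^sub>R b" and "b' = s *\<^sub>R b + t *\<^sub>R a"
  shows "a' \<bullet> (X *v a') + b' \<bullet> (X *v b') = (s\<^sup>2 + t\<^sup>2) * (a \<bullet> (X *v a) + b \<bullet> (X *v b))"
  using symmetric_inner_commute[OF assms(1), of a b] unfolding assms(2,3)
  by (simp add: matrix_vector_right_distrib matrix_vector_mult_diff_distrib matrix_vector_mult_scaleR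
      inner_simps power2_eq_square algebra_simps)

section \<open>Stability of the closed loop\<close>

text \<open>
  Evaluate the Lyapunov equation at an eigenvector \<open>v\<close> of \<open>sqrt g * (A + B F)\<close> with eigenvalue \<open>c\<close>.
  If \<open>|c| \<ge> 1\<close>, the last term alone is at least the left-hand side, which forces \<open>C v = 0\<close> and
  \<open>F v = 0\<close>. Then \<open>A + B F\<close> and \<open>A + L C\<close> agree on \<open>v\<close> for every \<open>L\<close>, so \<open>c / sqrt g\<close>,
  of modulus at least one, is an eigenvalue of every \<open>A + L C\<close>, contradicting detectability.
  Here \<open>X\<close> may be singular, so the equation alone does not give stability.
\<close>

lemma lyapunov_closed_loop_spectrum:
  fixes A :: "real^'n^'n" and B :: "real^'m^'n" and C :: "real^'n^'p" and F :: "real^'n^'m"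
  assumes g: "0 < g" "g \<le> 1" and X: "X \<in> psd_mats" and R: "R \<in> pd_mats" and "detectable A C"
    and lyap: "\<And>x. x \<bullet> (X *v x) = (C *v x) \<bullet> (C *v x) + (F *v x) \<bullet> (R *v (F *v x))
         + g * (((A + B ** F) *v x) \<bullet> (X *v ((A + B ** F) *v x)))"
    and c: "c \<in> complex_spectrum (sqrt g *\<^sub>R (A + B ** F))"
  shows "cmod c < 1"
proof (rule ccontr)
  assume "\<not> cmod c < 1"
  then have c1: "1 \<le> cmod c" by simp
  then have c2: "1 \<le> (Re c)\<^sup>2 + (Im c)\<^sup>2"
    by (simp add: cmod_power2[symmetric])
  let ?K = "A + B ** F"
  obtain v :: "complex^'n" where v: "v \<noteq> 0"
    and ev: "map_matrix complex_of_real (sqrt g *\<^sub>R ?K) *v v = c *s v"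
    using c unfolding complex_spectrum_def by blast
  define a b where "a = re_vec v" and "b = im_vec v"
  have Ka: "sqrt g *\<^sub>R (?K *v a) = Re c *\<^sub>R a - Im c *\<^sub>R b"
    and Kb: "sqrt g *\<^sub>R (?K *v b) = Re c *\<^sub>R b + Im c *\<^sub>R a"
    using ev unfolding complexified_eigenvector_iff a_def b_def
    by (simp_all add: scaleR_matrix_vector_assoc)
  define q where "q = (\<lambda>x. x \<bullet> (X *v x))"
  have q0: "0 \<le> q x" for x
    using X by (simp add: q_def psd_mats_def)
  have "X \<in> symmetric_mats"
    using X by (simp add: psd_mats_def)
  then have "q (sqrt g *\<^sub>R (?K *v a)) + q (sqrt g *\<^sub>R (?K *v b)) = ((Re c)\<^sup>2 + (Im c)\<^sup>2) * (q a + q b)"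
    unfolding q_def using Ka Kb by (rule quadratic_form_scaled_rotation)
  moreover have "q (sqrt g *\<^sub>R x) = g * q x" for x
    using g by (simp add: q_def matrix_vector_mult_scaleR flip: mult.assoc)
  ultimately have "g * q (?K *v a) + g * q (?K *v b) \<ge> q a + q b"
    using mult_right_mono[OF c2, of "q a + q b"] q0[of a] q0[of b] by simp
  moreover have R0: "0 \<le> u \<bullet> (R *v u)" for u
    using R by (cases "u = 0") (auto simp: pd_mats_def less_imp_le)
  ultimately have "(C *v a) \<bullet> (C *v a) = 0" "(C *v b) \<bullet> (C *v b) = 0"
    and "(F *v a) \<bullet> (R *v (F *v a)) = 0" "(F *v b) \<bullet> (R *v (F *v b)) = 0"
    using lyap[of a] lyap[of b] R0[of "F *v a"] R0[of "F *v b"]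
      inner_ge_zero[of "C *v a"] inner_ge_zero[of "C *v b"]
    unfolding q_def by linarith+
  then have 0: "C *v a = 0" "C *v b = 0" "F *v a = 0" "F *v b = 0"
    using R unfolding pd_mats_def by force+
  obtain L :: "real^'p^'n" where L: "spectral_radius (A + L ** C) < 1"
    using \<open>detectable A C\<close> unfolding detectable_def by blast
  define d where "d = c / complex_of_real (sqrt g)"
  have d: "Re d = Re c / sqrt g" "Im d = Im c / sqrt g"
    unfolding d_def by (simp_all only: Re_divide_of_real Im_divide_of_real)
  have eq: "?K *v a = A *v a" "?K *v b = A *v b" "(A + L ** C) *v a = A *v a" "(A + L ** C) *v b = A *v b"
    by (simp_all add: matrix_vector_mult_add_rdistrib matrix_vector_mul_assoc[symmetric] 0)
  have unscale: "x = (1 / sqrt g) *\<^sub>R y" if "sqrt g *\<^sub>R x = y" for x y :: "real^'n"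
    using that g by auto
  have "map_matrix complex_of_real (A + L ** C) *v v = d *s v"
    unfolding complexified_eigenvector_iff a_def[symmetric] b_def[symmetric] eq d
    using unscale[OF Ka] unscale[OF Kb] eq
    by (simp add: scaleR_diff_right scaleR_add_right divide_inverse mult.commute)
  with v have "d \<in> complex_spectrum (A + L ** C)"
    unfolding complex_spectrum_def by blast
  then have "cmod d < 1"
    using cmod_eigenvalue_le_spectral_radius L by fastforce
  moreover have "sqrt g \<le> cmod c"
    using c1 g order.trans[of "sqrt g" 1 "cmod c"] by simp
  then have "1 \<le> cmod d"
    using g by (simp add: d_def norm_divide)
  ultimately show False by simp
qed

section \<open>State-input vectors and the closed loop\<close>

lemma sum_UNIV_sum: "(\<Sum>i\<in>UNIV. f i) = (\<Sum>a\<in>UNIV. f (Inl a)) + (\<Sum>b\<in>UNIV. f (Inr b))"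
  for f :: "('a::finite + 'b::finite) \<Rightarrow> 'c::comm_monoid_add"
  by (subst UNIV_Plus_UNIV[symmetric], subst sum.Plus) auto

text \<open>
  The block column of the identity and \<open>F\<close>, which maps a state \<open>x\<close> to the pair of \<open>x\<close> and the input
  \<open>F x\<close>; its range is the graph of \<open>F\<close>. Together with the block row of \<open>A\<close> and \<open>B\<close>, which maps a state
  and an input to the next state, it factors \<open>closed_loop A B F\<close> through the state space.
\<close>

definition feedback_graph :: "real^'n^'m \<Rightarrow> real^'n^('n::finite + 'm::finite)" where
  "feedback_graph F = (\<chi> i j. case i of Inl a \<Rightarrow> mat 1 $ a $ j | Inr b \<Rightarrow> F $ b $ j)"

definition dynamics :: "real^'n^'n \<Rightarrow> real^'m^'n \<Rightarrow> real^('n::finite + 'm::finite)^'n" where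
  "dynamics A B = (\<chi> i j. case j of Inl a \<Rightarrow> A $ i $ a | Inr b \<Rightarrow> B $ i $ b)"

definition state_part :: "real^('n::finite + 'm::finite) \<Rightarrow> real^'n" where
  "state_part z = (\<chi> a. z $ Inl a)"

definition input_part :: "real^('n::finite + 'm::finite) \<Rightarrow> real^'m" where
  "input_part z = (\<chi> b. z $ Inr b)"

lemma sum_mat_1_mult:
  "(\<Sum>k\<in>UNIV. mat 1 $ i $ k * f k) = (f i :: real)" "(\<Sum>k\<in>UNIV. f k * mat 1 $ k $ i) = (f i :: real)"
  "(\<Sum>k\<in>UNIV. mat 1 $ k $ i * f k) = (f i :: real)"
  by (simp_all add: mat_def if_distrib[where f = "\<lambda>x. x * _"] if_distrib[where f = "\<lambda>x. _ * x"]
      sum.delta sum.delta' cong: if_cong)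

lemma feedback_graph_mult_vec:
  "state_part (feedback_graph F *v x) = x" "input_part (feedback_graph F *v x) = F *v x"
  by (simp_all add: state_part_def input_part_def feedback_graph_def matrix_vector_mult_def
      vec_eq_iff sum_mat_1_mult)

lemma closed_loop_factorization: "closed_loop A B F = feedback_graph F ** dynamics A B"
  by (simp add: vec_eq_iff closed_loop_def block_mat_def feedback_graph_def dynamics_def
      matrix_matrix_mult_def sum_mat_1_mult split: sum.split)

text \<open>
  The product of the two factors of the large closed loop in the other order is \<open>A + B F\<close>. This is how the small closed
  loop determines the long-run behaviour of the large one.
\<close>

lemma dynamics_feedback_graph: "dynamics A B ** feedback_graph F = A + B ** F"
  by (simp add: vec_eq_iff feedback_graph_def dynamics_def matrix_matrix_mult_def sum_UNIV_sum sum_mat_1_mult)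

lemma q_matrix_factorization:
  "q_matrix A B Q R g X = stage_cost Q R + g *\<^sub>R (transpose (dynamics A B) ** X ** dynamics A B)"
  by (simp add: vec_eq_iff q_matrix_def stage_cost_def block_mat_def dynamics_def transpose_def
      matrix_matrix_mult_def split: sum.split)

lemma inner_stage_cost:
  "z \<bullet> (stage_cost Q R *v z) = state_part z \<bullet> (Q *v state_part z) + input_part z \<bullet> (R *v input_part z)"
  by (simp add: stage_cost_def block_mat_def state_part_def input_part_def inner_vec_def
      matrix_vector_mult_def sum_UNIV_sum)

section \<open>Greedy feedback and the Bellman operator\<close>

lemma stage_cost_psd:
  assumes "Q \<in> psd_mats" "R \<in> psd_mats"
  shows "stage_cost Q R \<in> psd_mats"
proof -
  have "transpose (stage_cost Q R) = stage_cost (transpose Q) (transpose R)"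
    by (simp add: vec_eq_iff stage_cost_def block_mat_def transpose_def split: sum.split)
  with assms show ?thesis
    by (simp add: psd_mats_def symmetric_mats_def inner_stage_cost)
qed

lemma pd_imp_psd: "M \<in> pd_mats \<Longrightarrow> M \<in> psd_mats"
  unfolding pd_mats_def psd_mats_def by (auto, metis inner_zero_left less_imp_le order_refl)

lemma pd_add_psd: "M \<in> pd_mats \<Longrightarrow> N \<in> psd_mats \<Longrightarrow> M + N \<in> pd_mats"
  unfolding psd_mats_def pd_mats_def symmetric_mats_def
  by (auto simp: transpose_def vec_eq_iff matrix_vector_mult_add_rdistrib inner_add_right add_pos_nonneg)

lemma block22_psd:
  fixes W :: "real^('n::finite + 'm::finite)^('n + 'm)"
  assumes "W \<in> psd_mats"
  shows "block22 W \<in> psd_mats"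
proof -
  \<comment> \<open>The embedding of the inputs into the state-input pairs, so that the block is a congruence.\<close>
  define E :: "real^'m^('n + 'm)" where "E = (\<chi> i j. case i of Inl a \<Rightarrow> 0 | Inr b \<Rightarrow> mat 1 $ b $ j)"
  have "block22 W = transpose E ** W ** E"
    by (simp add: vec_eq_iff block22_def E_def transpose_def matrix_matrix_mult_def sum_UNIV_sum
        sum_mat_1_mult)
  then show ?thesis
    using assms psd_congruence by metis
qed

lemma stage_cost_plus_psd_admissible:
  assumes "Q \<in> psd_mats" "R \<in> pd_mats" "W \<in> psd_mats"
  shows "stage_cost Q R + W \<in> admissible"
proof -
  have "block22 (stage_cost Q R + W) = R + block22 W"
    by (simp add: vec_eq_iff block22_def stage_cost_def block_mat_def)
  then show ?thesis
    unfolding admissible_def using assms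
    by (simp add: psd_add stage_cost_psd pd_imp_psd pd_add_psd block22_psd)
qed

lemma admissible_nonzero:
  fixes P :: "real^('n::finite + 'm::finite)^('n + 'm)"
  assumes "P \<in> admissible"
  shows "P \<noteq> 0"
proof
  assume "P = 0"
  then have "block22 P = 0"
    by (simp add: block22_def vec_eq_iff)
  then have "(0::real^'m^'m) \<in> pd_mats"
    using assms by (simp add: admissible_def)
  then have "\<forall>x :: real^'m. x = 0"
    by (simp add: pd_mats_def)
  then show False
    using axis_eq_0_iff[of undefined "1::real"] zero_neq_one by metis
qed

text \<open>
  For each fixed state \<open>x\<close>, the input \<open>greedy_gain P *v x\<close> minimises the quadratic form of an admissible
  \<open>P\<close> at the pair of \<open>x\<close> and the input.
\<close>

definition greedy_gain :: "real^('n::finite + 'm::finite)^('n + 'm) \<Rightarrow> real^'n^'m" where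
  "greedy_gain P = - (matrix_inv (block22 P) ** transpose (block12 P))"

lemma pd_matrix_inv:
  assumes "M \<in> pd_mats"
  shows "M ** matrix_inv M = mat 1"
proof -
  have "\<forall>x. M *v x = 0 \<longrightarrow> x = 0"
    using assms unfolding pd_mats_def by force
  then obtain N where "N ** M = mat 1"
    using matrix_left_invertible_ker by blast
  then have "M ** N = mat 1 \<and> N ** M = mat 1"
    using matrix_left_right_inverse by blast
  then show ?thesis
    unfolding matrix_inv_def by (rule someI2) blast
qed

lemma matrix_mult_minus_right: "M ** (- N) = - (M ** N)" for N :: "real^'n^'m"
  using matrix_scalar_ac[of M "-1" N] scalar_matrix_assoc[of "-1" M N] by simp

lemma mult_feedback_graph_input_rows:
  assumes "P \<in> symmetric_mats"
  shows "(P ** feedback_graph F) $ Inr b $ j = (transpose (block12 P) + block22 P ** F) $ b $ j"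
proof -
  have "P $ Inr b $ Inl j = P $ Inl j $ Inr b"
    using assms by (auto simp: symmetric_mats_def transpose_def vec_eq_iff)
  then show ?thesis
    by (simp add: matrix_matrix_mult_def feedback_graph_def sum_UNIV_sum sum_mat_1_mult
        block12_def block22_def transpose_def)
qed

text \<open>
  The stationarity condition of the minimisation: on the graph of the greedy feedback, the gradient of
  the quadratic form of \<open>P\<close> has no input component.
\<close>

lemma mult_greedy_graph_input_rows:
  assumes "P \<in> admissible"
  shows "(P ** feedback_graph (greedy_gain P)) $ Inr b = 0"
proof -
  have "block22 P ** greedy_gain P = - transpose (block12 P)"
    using assms unfolding admissible_def greedy_gain_def
    by (simp add: matrix_mult_minus_right matrix_mul_assoc pd_matrix_inv)
  then show ?thesis
    using assms unfolding admissible_def psd_mats_def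
    by (simp add: vec_eq_iff mult_feedback_graph_input_rows)
qed

text \<open>
  When the input rows vanish, \<open>F\<close> does not enter. Applied to stationarity, this makes the mixed terms
  in the completion of the square below independent of the feedback.
\<close>

lemma transpose_feedback_graph_mult:
  assumes "\<And>b. W $ Inr b = 0"
  shows "transpose (feedback_graph F) ** W = (\<chi> a. W $ Inl a)"
  using assms
  by (simp add: vec_eq_iff transpose_def feedback_graph_def matrix_matrix_mult_def sum_UNIV_sum
        mat_def if_distrib[where f = "\<lambda>x. x * _"] cong: if_cong)

lemma congruence_greedy_graph:
  assumes "P \<in> admissible"
  shows "transpose (feedback_graph (greedy_gain P)) ** P ** feedback_graph (greedy_gain P)
       = (\<chi> a. (P ** feedback_graph (greedy_gain P)) $ Inl a)"
  unfolding matrix_mul_assoc[symmetric]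
  by (rule transpose_feedback_graph_mult[OF mult_greedy_graph_input_rows[OF assms]])

lemma matrix_mult_diff:
  fixes M N :: "real^'n^'m"
  shows "(M - N) ** K = M ** K - N ** K" "J ** (M - N) = J ** M - J ** N"
  by (simp_all add: matrix_matrix_mult_def vec_eq_iff left_diff_distrib right_diff_distrib sum_subtractf)

text \<open>
  Completing the square. With \<open>S\<close> and \<open>G\<close> the graph maps of \<open>F\<close> and of the greedy feedback,
  stationarity makes both mixed terms equal to \<open>G\<^sup>T P G\<close>, so the difference is
  \<open>(S - G)\<^sup>T P (S - G)\<close>.
\<close>

lemma greedy_gain_optimal:
  fixes P :: "real^('n::finite + 'm::finite)^('n + 'm)"
  assumes P: "P \<in> admissible"
  shows "transpose (feedback_graph F) ** P ** feedback_graph F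
       - transpose (feedback_graph (greedy_gain P)) ** P ** feedback_graph (greedy_gain P) \<in> psd_mats"
proof -
  let ?S = "feedback_graph F" and ?G = "feedback_graph (greedy_gain P)"
  have sym: "transpose P = P" and psd: "P \<in> psd_mats"
    using P by (auto simp: admissible_def psd_mats_def symmetric_mats_def)
  have SG: "transpose ?S ** P ** ?G = transpose ?G ** P ** ?G"
    unfolding matrix_mul_assoc[symmetric]
    by (simp only: transpose_feedback_graph_mult[OF mult_greedy_graph_input_rows[OF P]])
  then have "transpose (transpose ?S ** P ** ?G) = transpose (transpose ?G ** P ** ?G)"
    by simp
  then have GS: "transpose ?G ** P ** ?S = transpose ?G ** P ** ?G"
    by (simp add: matrix_transpose_mul sym matrix_mul_assoc)
  have "transpose (?S - ?G) = transpose ?S - transpose ?G"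
    by (simp add: transpose_def vec_eq_iff)
  then have "transpose (?S - ?G) ** P ** (?S - ?G)
      = transpose ?S ** P ** ?S - transpose ?G ** P ** ?G"
    by (simp add: matrix_mult_diff SG GS)
  then show ?thesis
    using psd_congruence[OF psd] by metis
qed

lemma bellman_eq:
  assumes "P \<in> admissible"
  shows "bellman A B Q R g P = stage_cost Q R
    + g *\<^sub>R (transpose (closed_loop A B (greedy_gain P)) ** P ** closed_loop A B (greedy_gain P))"
  using admissible_nonzero[OF assms] by (simp add: bellman_def greedy_gain_def Let_def)

lemma bellman_admissible:
  assumes "Q \<in> psd_mats" "R \<in> pd_mats" "0 \<le> g" "P \<in> admissible \<union> {0}"
  shows "bellman A B Q R g P \<in> admissible"
proof (cases "P = 0")
  case True
  then show ?thesis
    using stage_cost_plus_psd_admissible[OF assms(1,2) zero_psd]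
    by (simp add: bellman_def)
next
  case False
  then have P: "P \<in> admissible" using assms by simp
  then have "P \<in> psd_mats" by (simp add: admissible_def)
  then show ?thesis
    unfolding bellman_eq[OF P]
    by (intro stage_cost_plus_psd_admissible psd_scaleR psd_congruence assms)
qed

text \<open>
  The inequality behind the whole bound: one Bellman step costs no more than one step with a
  feedback \<open>F\<close> that is fixed in advance. At \<open>P = 0\<close> both sides are the stage cost.
\<close>

lemma bellman_le_policy_evaluation:
  assumes "0 \<le> g" and "P \<in> admissible \<union> {0}"
  shows "bellman A B Q R g P \<preceq>\<^sub>L
    stage_cost Q R + g *\<^sub>R (transpose (closed_loop A B F) ** P ** closed_loop A B F)"
proof (cases "P = 0")
  case True
  then show ?thesis
    by (simp add: loewner_le_def bellman_def zero_psd)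
next
  case False
  then have P: "P \<in> admissible" using assms by simp
  let ?S = "feedback_graph F" and ?G = "feedback_graph (greedy_gain P)" and ?T = "dynamics A B"
  have "transpose ?T ** (transpose ?S ** P ** ?S - transpose ?G ** P ** ?G) ** ?T
      = transpose (closed_loop A B F) ** P ** closed_loop A B F
        - transpose (closed_loop A B (greedy_gain P)) ** P ** closed_loop A B (greedy_gain P)"
    by (simp only: closed_loop_factorization matrix_transpose_mul matrix_mult_diff matrix_mul_assoc)
  then have "stage_cost Q R + g *\<^sub>R (transpose (closed_loop A B F) ** P ** closed_loop A B F)
        - bellman A B Q R g P
      = g *\<^sub>R (transpose ?T ** (transpose ?S ** P ** ?S - transpose ?G ** P ** ?G) ** ?T)"
    unfolding bellman_eq[OF P] by (simp only: scaleR_diff_right add_diff_cancel_left)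
  also have "\<dots> \<in> psd_mats"
    by (intro psd_scaleR psd_congruence greedy_gain_optimal P assms)
  finally show ?thesis
    unfolding loewner_le_def .
qed

section \<open>The Riccati solution\<close>

lemma q_matrix_admissible:
  assumes "Q \<in> psd_mats" "R \<in> pd_mats" "0 \<le> g" "X \<in> psd_mats"
  shows "q_matrix A B Q R g X \<in> admissible"
  unfolding q_matrix_factorization
  by (intro stage_cost_plus_psd_admissible psd_scaleR psd_congruence assms)

lemma greedy_gain_q_matrix:
  assumes "X \<in> psd_mats"
  shows "greedy_gain (q_matrix A B Q R g X) = riccati_gain A B R g X"
proof -
  have X: "transpose X = X"
    using assms by (simp add: psd_mats_def symmetric_mats_def)
  have "block22 (q_matrix A B Q R g X) = R + g *\<^sub>R (transpose B ** X ** B)"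
    and "block12 (q_matrix A B Q R g X) = g *\<^sub>R (transpose A ** X ** B)"
    by (simp_all add: vec_eq_iff block22_def block12_def q_matrix_def block_mat_def)
  then show ?thesis
    by (simp add: greedy_gain_def riccati_gain_def transpose_scalar matrix_transpose_mul X matrix_mul_assoc)
qed

lemma block_mat_mult_feedback_graph:
  "(block_mat M11 M12 M21 M22 ** feedback_graph F) $ Inl a = (M11 + M12 ** F) $ a"
  by (simp add: vec_eq_iff block_mat_def feedback_graph_def matrix_matrix_mult_def sum_UNIV_sum
      sum_mat_1_mult)

text \<open>
  The Riccati map is the minimal value of the quadratic form of the Q-matrix over the input: the
  correction term with the inverse is what the greedy feedback, here the Riccati gain, contributes.
\<close>

lemma q_matrix_congruence_riccati_gain:
  fixes A :: "real^'n^'n" and B :: "real^'m^'n"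
  assumes "Q \<in> psd_mats" "R \<in> pd_mats" "0 \<le> g" "X \<in> psd_mats"
  defines "F \<equiv> riccati_gain A B R g X"
  shows "transpose (feedback_graph F) ** q_matrix A B Q R g X ** feedback_graph F = riccati A B Q R g X"
proof -
  let ?P = "q_matrix A B Q R g X"
  have F: "greedy_gain ?P = F"
    unfolding F_def by (rule greedy_gain_q_matrix[OF assms(4)])
  have "transpose (feedback_graph F) ** ?P ** feedback_graph F = (\<chi> a. (?P ** feedback_graph F) $ Inl a)"
    using congruence_greedy_graph[OF q_matrix_admissible[OF assms(1-4)], where A1 = A and B1 = B] unfolding F .
  also have "\<dots> = Q + g *\<^sub>R (transpose A ** X ** A) + (g *\<^sub>R (transpose A ** X ** B)) ** F"
    unfolding q_matrix_def block_mat_mult_feedback_graph by (simp add: vec_eq_iff)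
  also have "\<dots> = riccati A B Q R g X"
    by (simp add: F_def riccati_gain_def riccati_def matrix_mult_minus_right matrix_mul_assoc)
  finally show ?thesis .
qed

text \<open>
  For a solution \<open>X\<close> of the Riccati equation, compressing \<open>P\<close> to the graph of the Riccati gain gives back
  \<open>X\<close>. Since the gain is also greedy for \<open>P\<close>, this says that \<open>P\<close> is a fixed point of the Bellman
  operator.
\<close>

lemma q_matrix_lyapunov:
  fixes A :: "real^'n^'n" and B :: "real^'m^'n"
  assumes "Q \<in> psd_mats" "R \<in> pd_mats" "0 \<le> g" "X \<in> psd_mats"
    and X: "X = riccati A B Q R g X"
  defines "P \<equiv> q_matrix A B Q R g X" and "G \<equiv> closed_loop A B (riccati_gain A B R g X)"
  shows "P = stage_cost Q R + g *\<^sub>R (transpose G ** P ** G)"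
proof -
  let ?S = "feedback_graph (riccati_gain A B R g X)" and ?T = "dynamics A B"
  have "transpose G ** P ** G = transpose ?T ** (transpose ?S ** P ** ?S) ** ?T"
    by (simp add: G_def closed_loop_factorization matrix_transpose_mul matrix_mul_assoc)
  also have "\<dots> = transpose ?T ** X ** ?T"
    using q_matrix_congruence_riccati_gain[OF assms(1-4), of A B] X unfolding P_def by metis
  finally show ?thesis
    unfolding P_def q_matrix_factorization by simp
qed

text \<open>
  The Lyapunov equation for \<open>X\<close> along \<open>A + B F\<close>, obtained from
  the identity \<open>X = S\<^sup>T P S\<close> for the graph map \<open>S\<close> of \<open>F\<close> by splitting \<open>P\<close> into stage cost and
  cost-to-go.
\<close>

lemma riccati_lyapunov:
  fixes A :: "real^'n^'n" and B :: "real^'m^'n"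
  assumes "Q \<in> psd_mats" "R \<in> pd_mats" "0 \<le> g" "X \<in> psd_mats"
    and X: "X = riccati A B Q R g X"
  defines "F \<equiv> riccati_gain A B R g X"
  shows "x \<bullet> (X *v x) = x \<bullet> (Q *v x) + (F *v x) \<bullet> (R *v (F *v x))
       + g * (((A + B ** F) *v x) \<bullet> (X *v ((A + B ** F) *v x)))"
proof -
  let ?S = "feedback_graph F" and ?T = "dynamics A B"
  let ?P = "q_matrix A B Q R g X"
  have TS: "?T *v (?S *v x) = (A + B ** F) *v x"
    by (simp add: matrix_vector_mul_assoc dynamics_feedback_graph)
  have "x \<bullet> (X *v x) = (?S *v x) \<bullet> (?P *v (?S *v x))"
    using q_matrix_congruence_riccati_gain[OF assms(1-4), of A B] X
    unfolding F_def by (metis inner_congruence)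
  also have "\<dots> = (?S *v x) \<bullet> (stage_cost Q R *v (?S *v x))
      + g * ((?T *v (?S *v x)) \<bullet> (X *v (?T *v (?S *v x))))"
    unfolding q_matrix_factorization
    by (simp only: matrix_vector_mult_add_rdistrib scaleR_matrix_vector_assoc[symmetric]
        inner_add_right inner_scaleR_right inner_congruence)
  finally show ?thesis
    by (simp add: inner_stage_cost feedback_graph_mult_vec TS)
qed

section \<open>Convergence and iteration\<close>

lemma mat_power_mult_vec: "mat_power M k *v x = (((*v) M) ^^ k) x"
  by (induction k) (simp_all add: mat_power_def matrix_vector_mul_assoc[symmetric])

lemma mat_power_Suc: "mat_power M (Suc k) = M ** mat_power M k"
  by (simp add: mat_power_def)

lemma mat_power_Suc_right: "mat_power M (Suc k) = mat_power M k ** M"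
  by (induction k) (simp_all add: mat_power_def matrix_mul_assoc)

lemma mat_power_transpose: "mat_power (transpose M) k = transpose (mat_power M k)"
proof (induction k)
  case (Suc k)
  then show ?case
    by (simp add: mat_power_Suc[of "transpose M"] mat_power_Suc_right[of M] matrix_transpose_mul)
qed (simp add: mat_power_def)

text \<open>
  With \<open>S\<close> the graph map and \<open>T\<close> the dynamics, \<open>(r S T)^(k+1) = S (r T S)^k (r T)\<close> and \<open>T S = A + B F\<close>,
  so the large matrix inherits convergence from the small one.
\<close>

lemma closed_loop_iterate_tendsto_0:
  fixes A :: "real^'n^'n" and B :: "real^'m^'n"
  assumes "\<And>c. c \<in> complex_spectrum (r *\<^sub>R (A + B ** F)) \<Longrightarrow> cmod c < 1"
  shows "(\<lambda>k. (((*v) (r *\<^sub>R closed_loop A B F)) ^^ k) x) \<longlonglongrightarrow> 0"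
proof -
  let ?H = "r *\<^sub>R closed_loop A B F" and ?N = "r *\<^sub>R (A + B ** F)"
  let ?S = "feedback_graph F" and ?T = "dynamics A B"
  define y where "y = r *\<^sub>R (?T *v x)"
  have "?H *v z = ?S *v (r *\<^sub>R (?T *v z))" for z
    by (simp add: closed_loop_factorization scaleR_matrix_vector_assoc[symmetric]
        matrix_vector_mult_scaleR matrix_vector_mul_assoc)
  moreover have "r *\<^sub>R (?T *v (?S *v w)) = ?N *v w" for w
    by (simp add: matrix_vector_mul_assoc dynamics_feedback_graph scaleR_matrix_vector_assoc)
  ultimately have "(((*v) ?H) ^^ Suc k) x = ?S *v ((((*v) ?N) ^^ k) y)" for k
    by (induction k) (simp_all add: y_def)
  moreover have "(\<lambda>k. ?S *v ((((*v) ?N) ^^ k) y)) \<longlonglongrightarrow> ?S *v 0"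
    by (intro isCont_tendsto_compose[OF _ iterate_tendsto_0_if_complex_spectrum_lt_1] assms
        linear_continuous_at matrix_vector_mul_bounded_linear)
  ultimately have "(\<lambda>k. (((*v) ?H) ^^ Suc k) x) \<longlonglongrightarrow> 0"
    by simp
  then show ?thesis
    by (rule LIMSEQ_imp_Suc)
qed

text \<open>
  Distributing \<open>g^k\<close> as \<open>sqrt g^k\<close> to either side, each entry is a bilinear form evaluated at two
  orbits of \<open>sqrt g * G\<close>.
\<close>

lemma scaled_congruence_power_tendsto_0:
  fixes G D :: "real^'n^'n"
  assumes g: "0 \<le> g" and lim: "\<And>x. (\<lambda>k. (((*v) (sqrt g *\<^sub>R G)) ^^ k) x) \<longlonglongrightarrow> 0"
  shows "(\<lambda>k. g ^ k *\<^sub>R (mat_power (transpose G) k ** D ** mat_power G k)) \<longlonglongrightarrow> 0"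
proof -
  define u where "u = (\<lambda>x k. (((*v) (sqrt g *\<^sub>R G)) ^^ k) x)"
  have u: "u x k = sqrt g ^ k *\<^sub>R (mat_power G k *v x)" for x k
    unfolding u_def mat_power_mult_vec
    by (induction k) (simp_all add: scaleR_matrix_vector_assoc[symmetric] matrix_vector_mult_scaleR)
  have entry: "M $ i $ j = axis i 1 \<bullet> (M *v axis j 1)" for M :: "real^'n^'n" and i j
    by (simp add: inner_axis' matrix_vector_mult_basis column_def)
  have "(g ^ k *\<^sub>R (mat_power (transpose G) k ** D ** mat_power G k)) $ i $ j
      = u (axis i 1) k \<bullet> (D *v u (axis j 1) k)" for i j k
  proof -
    have "sqrt g ^ k * sqrt g ^ k = g ^ k"
      using g by (simp add: power_mult_distrib[symmetric])
    then show ?thesis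
      unfolding mat_power_transpose vector_scaleR_component real_scaleR_def
        entry[of "transpose (mat_power G k) ** D ** mat_power G k"] inner_congruence u
      by (simp add: matrix_vector_mult_scaleR mult.assoc[symmetric])
  qed
  moreover have "(\<lambda>k. u x k \<bullet> (D *v u y k)) \<longlonglongrightarrow> 0 \<bullet> (D *v 0)" for x y
    using lim unfolding u_def
    by (intro tendsto_inner isCont_tendsto_compose[of _ "(*v) D"]
        linear_continuous_at matrix_vector_mul_bounded_linear)
  ultimately show ?thesis
    by (intro vec_tendstoI) simp
qed

text \<open>
  Subtracting the equation for \<open>Ps\<close> from the one-step bound with \<open>F\<close> gives, for every iterate \<open>Y\<close>,
  \<open>bellman Y - Ps \<preceq>\<^sub>L g G\<^sup>T (Y - Ps) G\<close>. Congruence and scaling are monotone in the Loewner order, so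
  the bounds compose. Throughout, \<open>F\<close> stays fixed although the greedy feedback of \<open>Y\<close>
  changes from step to step.
\<close>

lemma bellman_iterate_le:
  fixes A :: "real^'n^'n" and B :: "real^'m^'n" and Ps P :: "real^('n::finite + 'm::finite)^('n + 'm)"
  assumes "Q \<in> psd_mats" "R \<in> pd_mats" "0 \<le> g"
    and Ps: "Ps = stage_cost Q R + g *\<^sub>R (transpose (closed_loop A B F) ** Ps ** closed_loop A B F)"
    and P: "P \<in> admissible \<union> {0}"
  shows "(bellman A B Q R g ^^ k) P - Ps \<preceq>\<^sub>L
    g ^ k *\<^sub>R (mat_power (transpose (closed_loop A B F)) k ** (P - Ps) ** mat_power (closed_loop A B F) k)"
proof (induction k)
  case 0
  show ?case
    by (simp add: mat_power_def loewner_le_def zero_psd)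
next
  case (Suc k)
  let ?G = "closed_loop A B F"
  define Y where "Y = (bellman A B Q R g ^^ k) P"
  define M where "M = g ^ k *\<^sub>R (mat_power (transpose ?G) k ** (P - Ps) ** mat_power ?G k)"
  \<comment> \<open>One step from \<open>Y\<close> with the fixed feedback; it dominates the Bellman step.\<close>
  define W where "W = stage_cost Q R + g *\<^sub>R (transpose ?G ** Y ** ?G)"
  have "(bellman A B Q R g ^^ j) P \<in> admissible \<union> {0}" for j
  proof (induction j)
    case (Suc j)
    then show ?case
      using bellman_admissible[OF assms(1-3) Suc.IH] by simp
  qed (use P in simp)
  then have "Y \<in> admissible \<union> {0}"
    unfolding Y_def .
  then have "W - bellman A B Q R g Y \<in> psd_mats"
    using bellman_le_policy_evaluation[OF assms(3)] unfolding loewner_le_def W_def by blast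
  moreover have "g *\<^sub>R (transpose ?G ** (M - (Y - Ps)) ** ?G) \<in> psd_mats"
    using Suc.IH unfolding loewner_le_def M_def[symmetric] Y_def[symmetric]
    by (intro psd_scaleR psd_congruence assms)
  ultimately have psd: "W - bellman A B Q R g Y + g *\<^sub>R (transpose ?G ** (M - (Y - Ps)) ** ?G) \<in> psd_mats"
    by (rule psd_add)
  have "g *\<^sub>R (transpose ?G ** Ps ** ?G) = Ps - stage_cost Q R"
    using Ps by (metis add_diff_cancel_left')
  then have "W - bellman A B Q R g Y + g *\<^sub>R (transpose ?G ** (M - (Y - Ps)) ** ?G)
      = g *\<^sub>R (transpose ?G ** M ** ?G) - (bellman A B Q R g Y - Ps)"
    unfolding W_def matrix_mult_diff scaleR_diff_right by simp
  also have "g *\<^sub>R (transpose ?G ** M ** ?G) = g ^ Suc k *\<^sub>R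
      (mat_power (transpose ?G) (Suc k) ** (P - Ps) ** mat_power ?G (Suc k))"
    unfolding M_def mat_power_Suc[of "transpose ?G"] mat_power_Suc_right[of ?G]
    by (simp add: matrix_scalar_ac scalar_matrix_assoc[symmetric] matrix_mul_assoc)
  finally show ?case
    using psd by (simp only: loewner_le_def Y_def funpow.simps o_apply)
qed

theorem theorem1:
  fixes A :: "real^'n^'n" and B :: "real^'m^'n" and C :: "real^'n^'p"
    and Q :: "real^'n^'n" and R :: "real^'m^'m" and \<gamma> :: real
    and Xs :: "real^'n^'n" and Fs :: "real^'n^'m" and Ps P :: "real^('n::finite + 'm::finite)^('n + 'm)"
  assumes "0 < \<gamma>" and "\<gamma> \<le> 1"
    and "Q \<in> psd_mats" and "R \<in> pd_mats"
    and "stabilizable A B"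
    and "Q = transpose C ** C" and "detectable A C"
    and "Xs \<in> psd_mats" and "Xs = riccati A B Q R \<gamma> Xs"
    and "Fs = riccati_gain A B R \<gamma> Xs"
    and "Ps = q_matrix A B Q R \<gamma> Xs"
    and "P \<in> admissible \<union> {0}"
  shows "(\<forall>k.
            (bellman A B Q R \<gamma> ^^ k) P - Ps
              = (bellman A B Q R \<gamma> ^^ k) P - (bellman A B Q R \<gamma> ^^ k) Ps
          \<and> (bellman A B Q R \<gamma> ^^ k) P - Ps
              \<preceq>\<^sub>L \<gamma> ^ k *\<^sub>R (mat_power (transpose (closed_loop A B Fs)) k ** (P - Ps)
                            ** mat_power (closed_loop A B Fs) k))
       \<and> (\<lambda>k. \<gamma> ^ k *\<^sub>R (mat_power (transpose (closed_loop A B Fs)) k ** (P - Ps)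
                            ** mat_power (closed_loop A B Fs) k)) \<longlonglongrightarrow> 0"
proof -
  have g: "0 \<le> \<gamma>" using \<open>0 < \<gamma>\<close> by simp
  note hyps = \<open>Q \<in> psd_mats\<close> \<open>R \<in> pd_mats\<close> g \<open>Xs \<in> psd_mats\<close>
  have fix_eq: "Ps = stage_cost Q R
      + \<gamma> *\<^sub>R (transpose (closed_loop A B Fs) ** Ps ** closed_loop A B Fs)"
    unfolding \<open>Ps = q_matrix A B Q R \<gamma> Xs\<close> \<open>Fs = riccati_gain A B R \<gamma> Xs\<close>
    by (rule q_matrix_lyapunov[OF hyps \<open>Xs = riccati A B Q R \<gamma> Xs\<close>])
  have Ps: "Ps \<in> admissible" "greedy_gain Ps = Fs"
    unfolding \<open>Ps = q_matrix A B Q R \<gamma> Xs\<close> \<open>Fs = riccati_gain A B R \<gamma> Xs\<close>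
    by (rule q_matrix_admissible[OF hyps], rule greedy_gain_q_matrix[OF \<open>Xs \<in> psd_mats\<close>])
  have "bellman A B Q R \<gamma> Ps = Ps"
    using fix_eq unfolding bellman_eq[OF Ps(1)] Ps(2) by (rule sym)
  then have "(bellman A B Q R \<gamma> ^^ k) Ps = Ps" for k
    by (induction k) simp_all
  moreover have "cmod c < 1" if c: "c \<in> complex_spectrum (sqrt \<gamma> *\<^sub>R (A + B ** Fs))" for c
  proof (rule lyapunov_closed_loop_spectrum[OF \<open>0 < \<gamma>\<close> \<open>\<gamma> \<le> 1\<close> \<open>Xs \<in> psd_mats\<close> \<open>R \<in> pd_mats\<close>
        \<open>detectable A C\<close> _ c])
    fix x
    have "x \<bullet> (Q *v x) = (C *v x) \<bullet> (C *v x)"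
      unfolding \<open>Q = transpose C ** C\<close> matrix_vector_mul_assoc[symmetric] by (rule inner_transpose_mult)
    then show "x \<bullet> (Xs *v x) = (C *v x) \<bullet> (C *v x) + (Fs *v x) \<bullet> (R *v (Fs *v x))
        + \<gamma> * (((A + B ** Fs) *v x) \<bullet> (Xs *v ((A + B ** Fs) *v x)))"
      using riccati_lyapunov[OF hyps \<open>Xs = riccati A B Q R \<gamma> Xs\<close>, of x]
      unfolding \<open>Fs = riccati_gain A B R \<gamma> Xs\<close> by simp
  qed
  then have "(\<lambda>k. \<gamma> ^ k *\<^sub>R (mat_power (transpose (closed_loop A B Fs)) k ** (P - Ps)
                            ** mat_power (closed_loop A B Fs) k)) \<longlonglongrightarrow> 0"
    by (intro scaled_congruence_power_tendsto_0 closed_loop_iterate_tendsto_0 g)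
  ultimately show ?thesis
    using bellman_iterate_le[OF \<open>Q \<in> psd_mats\<close> \<open>R \<in> pd_mats\<close> g fix_eq \<open>P \<in> admissible \<union> {0}\<close>]
    by simp
qed

end
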